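(* Let $\Sigma$ be a finite alphabet. For any set $\mathcal S$ of labelled transition systems over $\Sigma$, the following are equivalent: (1) there exists a $\nu$HML formula $\Delta$ with $[\![\Delta]\!]=\mathcal S$; (2) there exists a finite NAA $S$ with $[\![S]\!]=\mathcal S$; (3) there exists a finite DMTS $S$ with $[\![S]\!]=\mathcal S$. Furthermore, statements (2) and (3) remain equivalent if the finiteness requirements on the NAA and DMTS are dropped.
   Context: A labelled transition system (LTS) over $\Sigma$ is $(S,s^0,\to)$ with $s^0\in S$ and $\to\subseteq S\times\Sigma\times S$ image-finite (for each $s,a$ the set $\{s'\mid s\xrightarrow{a}s'\}$ is finite). $\nu$HML: HML formulae over a set $X$ of variables are given by $\phi::=\mathbf{tt}\mid\mathbf{ff}\mid x\mid\phi\wedge\phi\mid\phi\vee\phi\mid\langle a\rangle\phi\mid[a]\phi$ ($x\in X$, $a\in\Sigma$). Given an LTS $(S,s^0,\to)$ and an assignment $\sigma:X\to 2^S$, $[\![\mathbf{tt}]\!]\sigma=S$, $[\![\mathbf{ff}]\!]\sigma=\emptyset$, $[\![x]\!]\sigma=\sigma(x)$, $\wedge,\vee$ are intersection and union, $[\![\langle a\rangle\phi]\!]\sigma=\{s\mid\exists s\xrightarrow{a}s': s'\in[\![\phi]\!]\sigma\}$, $[\![[a]\phi]\!]\sigma=\{s\mid\forall s\xrightarrow{a}s': s'\in[\![\phi]\!]\sigma\}$. For a declaration $\Delta:X\to\mathrm{HML}(X)$, $[\![\Delta]\!]$ is the greatest assignment $\sigma$ (pointwise inclusion) with $\sigma(x)\subseteq[\![\Delta(x)]\!]\sigma$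 for all $x$. A $\nu$HML formula is $(X,X^0,\Delta)$ with $X^0\subseteq X$ finite sets and $\Delta$ a declaration; an LTS implements it if $s^0\in[\![\Delta]\!](x^0)$ for some $x^0\in X^0$; $[\![\Delta]\!]$ also denotes the set of its implementations. DMTS: $(S,S^0,\dashrightarrow,\longrightarrow)$ with $S^0\subseteq S$ finite, image-finite may relation $\dashrightarrow\subseteq S\times\Sigma\times S$, and disjunctive must relation $\longrightarrow\subseteq S\times 2^{\Sigma\times S}$ such that $s\longrightarrow N$ and $(a,t)\in N$ imply $s\overset{a}{\dashrightarrow}t$. A relation $R\subseteq S_1\times S_2$ is a DMTS modal refinement if for all $(s_1,s_2)\in R$: for all $s_1\overset{a}{\dashrightarrow}t_1$ there is $s_2\overset{a}{\dashrightarrow}t_2$ with $(t_1,t_2)\in R$; and for all $s_2\longrightarrow N_2$ there is $s_1\longrightarrow N_1$ such that each $(a,t_1)\in N_1$ has some $(a,t_2)\in N_2$ with $(t_1,t_2)\in R$. An LTS $(I,i^0,\to)$ is viewed as the DMTS $(I,\{i^0\},\to,\{(s,\{(a,t)\})\mid s\xrightarrow{a}t\})$. NAA: $(S,S^0,\mathrm{Tran})$ with $S^0\subseteq S$ finite and $\mathrm{Tran}:S\to 2^{\mathcal P_{\mathrm{fin}}(\Sigma\times S)}$. NAA modal refinement $R$: for $(s_1,s_2)\in R$ and $M_1\in\mathrm{Tran}_1(s_1)$ there is $M_2\in\mathrm{Tran}_2(s_2)$ such that every $(a,t_1)\in M_1$ has $(a,t_2)\in M_2$ with $(t_1,t_2)\in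 R$ and every $(a,t_2)\in M_2$ has $(a,t_1)\in M_1$ with $(t_1,t_2)\in R$. An LTS $(I,i^0,\to)$ is viewed as the NAA $(I,\{i^0\},\mathrm{Tran})$ with $\mathrm{Tran}(s)=\{\{(a,t)\mid s\xrightarrow{a}t\}\}$. In both DMTS and NAA a refinement is initialised if each initial state of the left side is related to some initial state of the right side; $S_1\le_m S_2$ means an initialised modal refinement exists; $[\![S]\!]$ is the set of LTS $I$ with $I\le_m S$.
   Formalization: The final clause is proved for NAA in which each Tran(s) is a finite set (automatic for finite NAA); without this it fails: with Tran(s0)={{(a,t_n)} | n}, t_n allowing exactly n steps, the NAA implements all finite chains but not the loop, which no DMTS can do. *)

theory Defs
  imports "HOL-Library.Infinite_Typeclass"
begin

text \<open>The alphabet \<open>\<Sigma>\<close> is the type \<open>'a\<close>, of class \<open>finite\<close> in the theorem. State sets and sets of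
  variables are explicit carriers, so that infinite ambient types contain the finite structures.\<close>

section \<open>Labelled transition systems\<close>

record ('a, 's) lts =
  lts_states :: "'s set"
  lts_init :: 's
  lts_trans :: "('s \<times> 'a \<times> 's) set"

definition image_finite :: "'s set \<Rightarrow> ('s \<times> 'a \<times> 's) set \<Rightarrow> bool" where
  "image_finite S T \<longleftrightarrow> (\<forall>s\<in>S. \<forall>a. finite {t. (s, a, t) \<in> T})"

definition is_lts :: "('a, 's) lts \<Rightarrow> bool" where
  "is_lts L \<longleftrightarrow> lts_init L \<in> lts_states L
     \<and> lts_trans L \<subseteq> lts_states L \<times> UNIV \<times> lts_states L
     \<and> image_finite (lts_states L) (lts_trans L)"

section \<open>The modal nu-calculus\<close>

datatype ('a, vars: 'x) hml =
    TT
  | FF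
  | Var 'x
  | And "('a, 'x) hml" "('a, 'x) hml"
  | Or "('a, 'x) hml" "('a, 'x) hml"
  | Dia 'a "('a, 'x) hml"
  | Box 'a "('a, 'x) hml"

primrec hml_sem :: "('a, 's) lts \<Rightarrow> ('a, 'x) hml \<Rightarrow> ('x \<Rightarrow> 's set) \<Rightarrow> 's set" where
  "hml_sem L TT \<sigma> = lts_states L"
| "hml_sem L FF \<sigma> = {}"
| "hml_sem L (Var x) \<sigma> = \<sigma> x"
| "hml_sem L (And \<phi> \<psi>) \<sigma> = hml_sem L \<phi> \<sigma> \<inter> hml_sem L \<psi> \<sigma>"
| "hml_sem L (Or \<phi> \<psi>) \<sigma> = hml_sem L \<phi> \<sigma> \<union> hml_sem L \<psi> \<sigma>"
| "hml_sem L (Dia a \<phi>) \<sigma> =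
     {s \<in> lts_states L. \<exists>s'. (s, a, s') \<in> lts_trans L \<and> s' \<in> hml_sem L \<phi> \<sigma>}"
| "hml_sem L (Box a \<phi>) \<sigma> =
     {s \<in> lts_states L. \<forall>s'. (s, a, s') \<in> lts_trans L \<longrightarrow> s' \<in> hml_sem L \<phi> \<sigma>}"

record ('a, 'x) nuhml =
  nu_vars :: "'x set"
  nu_init :: "'x set"
  nu_decl :: "'x \<Rightarrow> ('a, 'x) hml"

definition is_nuhml :: "('a, 'x) nuhml \<Rightarrow> bool" where
  "is_nuhml F \<longleftrightarrow> finite (nu_vars F) \<and> nu_init F \<subseteq> nu_vars F
     \<and> (\<forall>x\<in>nu_vars F. vars (nu_decl F x) \<subseteq> nu_vars F)"

text \<open>An assignment \<open>X \<rightarrow> 2\<^sup>S\<close> is a total function that is empty outside \<open>X\<close>; the order on functions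
  is then pointwise inclusion on \<open>X\<close>.\<close>

definition nu_assignment :: "('a, 's) lts \<Rightarrow> ('a, 'x) nuhml \<Rightarrow> ('x \<Rightarrow> 's set) \<Rightarrow> bool" where
  "nu_assignment L F \<sigma> \<longleftrightarrow>
     (\<forall>x\<in>nu_vars F. \<sigma> x \<subseteq> lts_states L) \<and> (\<forall>x. x \<notin> nu_vars F \<longrightarrow> \<sigma> x = {})"

definition nu_postfixed :: "('a, 's) lts \<Rightarrow> ('a, 'x) nuhml \<Rightarrow> ('x \<Rightarrow> 's set) \<Rightarrow> bool" where
  "nu_postfixed L F \<sigma> \<longleftrightarrow>
     nu_assignment L F \<sigma> \<and> (\<forall>x\<in>nu_vars F. \<sigma> x \<subseteq> hml_sem L (nu_decl F x) \<sigma>)"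

definition nu_sem :: "('a, 's) lts \<Rightarrow> ('a, 'x) nuhml \<Rightarrow> 'x \<Rightarrow> 's set" where
  "nu_sem L F = (GREATEST \<sigma>. nu_postfixed L F \<sigma>)"

lemma hml_sem_mono: "\<sigma> \<le> \<tau> \<Longrightarrow> hml_sem L \<phi> \<sigma> \<subseteq> hml_sem L \<phi> \<tau>"
  by (induction \<phi>) (auto simp: le_fun_def)

text \<open>The greatest assignment exists, so the description operator in the definition is harmless.\<close>

lemma nu_sem_greatest:
  shows "nu_postfixed L F (nu_sem L F)"
    and "nu_postfixed L F \<sigma> \<Longrightarrow> \<sigma> \<le> nu_sem L F"
proof -
  let ?P = "nu_postfixed L F"
  let ?m = "\<lambda>x. \<Union>\<sigma>\<in>Collect ?P. \<sigma> x"
  have up: "\<tau> \<le> ?m" if "?P \<tau>" for \<tau>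
    using that by (auto simp: le_fun_def)
  have m: "?P ?m"
  proof (rule nu_postfixed_def[THEN iffD2], intro conjI ballI)
    show "nu_assignment L F ?m"
      unfolding nu_postfixed_def nu_assignment_def by blast
  next
    fix x assume x: "x \<in> nu_vars F"
    show "?m x \<subseteq> hml_sem L (nu_decl F x) ?m"
    proof (rule UN_least)
      fix \<tau> assume \<tau>: "\<tau> \<in> Collect ?P"
      then have "\<tau> x \<subseteq> hml_sem L (nu_decl F x) \<tau>"
        using x by (auto simp: nu_postfixed_def)
      also have "\<dots> \<subseteq> hml_sem L (nu_decl F x) ?m"
        using \<tau> by (intro hml_sem_mono up) simp
      finally show "\<tau> x \<subseteq> hml_sem L (nu_decl F x) ?m" .
    qed
  qed
  have eq: "nu_sem L F = ?m"
    unfolding nu_sem_def by (rule Greatest_equality) (use m up in auto)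
  show "?P (nu_sem L F)"
    unfolding eq by (rule m)
  show "\<sigma> \<le> nu_sem L F" if "?P \<sigma>"
    unfolding eq using that by (rule up)
qed

definition nuhml_impls :: "('a, 'x) nuhml \<Rightarrow> ('a, 's) lts set" where
  "nuhml_impls F = {L. is_lts L \<and> (\<exists>x0\<in>nu_init F. lts_init L \<in> nu_sem L F x0)}"

section \<open>Disjunctive modal transition systems\<close>

record ('a, 'q) dmts =
  dmts_states :: "'q set"
  dmts_init :: "'q set"
  dmts_may :: "('q \<times> 'a \<times> 'q) set"
  dmts_must :: "('q \<times> ('a \<times> 'q) set) set"

definition is_dmts :: "('a, 'q) dmts \<Rightarrow> bool" where
  "is_dmts D \<longleftrightarrow> dmts_init D \<subseteq> dmts_states D \<and> finite (dmts_init D)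
     \<and> dmts_may D \<subseteq> dmts_states D \<times> UNIV \<times> dmts_states D
     \<and> image_finite (dmts_states D) (dmts_may D)
     \<and> dmts_must D \<subseteq> dmts_states D \<times> Pow (UNIV \<times> dmts_states D)
     \<and> (\<forall>s N a t. (s, N) \<in> dmts_must D \<and> (a, t) \<in> N \<longrightarrow> (s, a, t) \<in> dmts_may D)"

definition dmts_refinement ::
  "('a, 'p) dmts \<Rightarrow> ('a, 'q) dmts \<Rightarrow> ('p \<times> 'q) set \<Rightarrow> bool" where
  "dmts_refinement D1 D2 R \<longleftrightarrow> R \<subseteq> dmts_states D1 \<times> dmts_states D2
     \<and> (\<forall>(s1, s2)\<in>R.
          (\<forall>a t1. (s1, a, t1) \<in> dmts_may D1 \<longrightarrow>
             (\<exists>t2. (s2, a, t2) \<in> dmts_may D2 \<and> (t1, t2) \<in> R))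
        \<and> (\<forall>N2. (s2, N2) \<in> dmts_must D2 \<longrightarrow>
             (\<exists>N1. (s1, N1) \<in> dmts_must D1
                \<and> (\<forall>(a, t1)\<in>N1. \<exists>t2. (a, t2) \<in> N2 \<and> (t1, t2) \<in> R))))"

definition dmts_refines :: "('a, 'p) dmts \<Rightarrow> ('a, 'q) dmts \<Rightarrow> bool" where
  "dmts_refines D1 D2 \<longleftrightarrow>
     (\<exists>R. dmts_refinement D1 D2 R \<and> (\<forall>s1\<in>dmts_init D1. \<exists>s2\<in>dmts_init D2. (s1, s2) \<in> R))"

definition dmts_of_lts :: "('a, 's) lts \<Rightarrow> ('a, 's) dmts" where
  "dmts_of_lts L = \<lparr>dmts_states = lts_states L, dmts_init = {lts_init L},
     dmts_may = lts_trans L, dmts_must = {(s, {(a, t)}) | s a t. (s, a, t) \<in> lts_trans L}\<rparr>"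

definition dmts_impls :: "('a, 'q) dmts \<Rightarrow> ('a, 's) lts set" where
  "dmts_impls D = {L. is_lts L \<and> dmts_refines (dmts_of_lts L) D}"

section \<open>Nondeterministic acceptance automata\<close>

record ('a, 'q) naa =
  naa_states :: "'q set"
  naa_init :: "'q set"
  naa_tran :: "'q \<Rightarrow> ('a \<times> 'q) set set"

definition is_naa :: "('a, 'q) naa \<Rightarrow> bool" where
  "is_naa A \<longleftrightarrow> naa_init A \<subseteq> naa_states A \<and> finite (naa_init A)
     \<and> (\<forall>s\<in>naa_states A. naa_tran A s \<subseteq> Fpow (UNIV \<times> naa_states A))"

definition naa_refinement ::
  "('a, 'p) naa \<Rightarrow> ('a, 'q) naa \<Rightarrow> ('p \<times> 'q) set \<Rightarrow> bool" where
  "naa_refinement A1 A2 R \<longleftrightarrow> R \<subseteq> naa_states A1 \<times> naa_states A2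
     \<and> (\<forall>(s1, s2)\<in>R. \<forall>M1\<in>naa_tran A1 s1. \<exists>M2\<in>naa_tran A2 s2.
          (\<forall>(a, t1)\<in>M1. \<exists>t2. (a, t2) \<in> M2 \<and> (t1, t2) \<in> R)
        \<and> (\<forall>(a, t2)\<in>M2. \<exists>t1. (a, t1) \<in> M1 \<and> (t1, t2) \<in> R))"

definition naa_refines :: "('a, 'p) naa \<Rightarrow> ('a, 'q) naa \<Rightarrow> bool" where
  "naa_refines A1 A2 \<longleftrightarrow>
     (\<exists>R. naa_refinement A1 A2 R \<and> (\<forall>s1\<in>naa_init A1. \<exists>s2\<in>naa_init A2. (s1, s2) \<in> R))"

definition naa_of_lts :: "('a, 's) lts \<Rightarrow> ('a, 's) naa" where
  "naa_of_lts L = \<lparr>naa_states = lts_states L, naa_init = {lts_init L},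
     naa_tran = (\<lambda>s. {{(a, t). (s, a, t) \<in> lts_trans L}})\<rparr>"

definition naa_impls :: "('a, 'q) naa \<Rightarrow> ('a, 's) lts set" where
  "naa_impls A = {L. is_lts L \<and> naa_refines (naa_of_lts L) A}"

text \<open>Counterpart for acceptance automata of image-finiteness; it holds for every finite automaton
  over a finite alphabet.\<close>

definition naa_locally_finite :: "('a, 'q) naa \<Rightarrow> bool" where
  "naa_locally_finite A \<longleftrightarrow> (\<forall>s\<in>naa_states A. finite (naa_tran A s))"

lemma finite_naa_locally_finite:
  fixes A :: "('a::finite, 'q) naa"
  assumes "is_naa A" "finite (naa_states A)"
  shows "naa_locally_finite A"
  unfolding naa_locally_finite_def
proof
  fix s assume "s \<in> naa_states A"
  then have "naa_tran A s \<subseteq> Pow (UNIV \<times> naa_states A)"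
    using assms(1) by (auto simp: is_naa_def Fpow_def)
  moreover have "finite (Pow ((UNIV :: 'a set) \<times> naa_states A))"
    using assms(2) by simp
  ultimately show "finite (naa_tran A s)"
    by (rule finite_subset)
qed

subsection \<open>Infinite automata that are not locally finite\<close>

text \<open>The implementations of the following automaton are, up to bisimilarity, the finite chains with
  at least one transition. A system with finitely many initial states and an image-finite may
  relation that admits all of them also admits the infinite chain. So without local finiteness, an
  infinite automaton need not have an equivalent disjunctive modal transition system.\<close>

definition chains_naa :: "(unit, nat) naa" where
  "chains_naa = \<lparr>naa_states = UNIV, naa_init = {0}, naa_tran = (\<lambda>s. case s of
       0 \<Rightarrow> range (\<lambda>n. {((), Suc n)})
     | Suc 0 \<Rightarrow> {{}}
     | Suc (Suc k) \<Rightarrow> {{((), Suc k)}})\<rparr>"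

definition chain :: "nat \<Rightarrow> (unit, nat) lts" where
  "chain n = \<lparr>lts_states = UNIV, lts_init = n, lts_trans = {(Suc k, (), k) | k. True}\<rparr>"

definition loop :: "(unit, nat) lts" where
  "loop = \<lparr>lts_states = {0}, lts_init = 0, lts_trans = {(0, (), 0)}\<rparr>"

lemma is_naa_chains_naa: "is_naa chains_naa"
  by (auto simp: is_naa_def chains_naa_def Fpow_def split: nat.splits)

lemma is_lts_chain: "is_lts (chain n)"
proof -
  have "finite {t. \<exists>k. s = Suc k \<and> t = k}" for s :: nat
    by (rule finite_subset[of _ "{..s}"]) auto
  then show ?thesis
    by (auto simp: is_lts_def chain_def image_finite_def)
qed

lemma is_lts_loop: "is_lts loop"
  by (auto simp: is_lts_def loop_def image_finite_def)

lemma chain_in_chains_naa: "chain (Suc n) \<in> naa_impls chains_naa"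
proof -
  let ?R = "insert (Suc n, 0) {(k, Suc k) | k. True}"
  have "naa_refinement (naa_of_lts (chain (Suc n))) chains_naa ?R"
    by (auto simp: naa_refinement_def naa_of_lts_def chain_def chains_naa_def split: nat.splits)
  then show ?thesis
    unfolding naa_impls_def naa_refines_def
    using is_lts_chain by (auto simp: naa_of_lts_def chain_def chains_naa_def)
qed

lemma loop_notin_chains_naa: "loop \<notin> naa_impls chains_naa"
proof
  assume "loop \<in> naa_impls chains_naa"
  then obtain R where R: "naa_refinement (naa_of_lts loop) chains_naa R" and init: "(0, 0) \<in> R"
    by (auto simp: naa_impls_def naa_refines_def naa_of_lts_def loop_def chains_naa_def)
  have step: "\<exists>M\<in>naa_tran chains_naa s. \<exists>t. ((), t) \<in> M \<and> (0, t) \<in> R" if "(0, s) \<in> R" for s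
  proof -
    have "\<forall>M1\<in>naa_tran (naa_of_lts loop) 0. \<exists>M2\<in>naa_tran chains_naa s.
        (\<forall>(a, t1)\<in>M1. \<exists>t2. (a, t2) \<in> M2 \<and> (t1, t2) \<in> R)
      \<and> (\<forall>(a, t2)\<in>M2. \<exists>t1. (a, t1) \<in> M1 \<and> (t1, t2) \<in> R)"
      using R[unfolded naa_refinement_def, THEN conjunct2, THEN bspec, OF that]
      by (simp only: prod.case)
    moreover have "naa_tran (naa_of_lts loop) 0 = {{((), 0)}}"
      by (auto simp: naa_of_lts_def loop_def)
    ultimately show ?thesis
      by auto
  qed
  have "(0, Suc n) \<notin> R" for n
  proof (induction n)
    case 0
    then show ?case using step[of "Suc 0"] by (auto simp: chains_naa_def)
  next
    case (Suc n)
    then show ?case using step[of "Suc (Suc n)"] by (auto simp: chains_naa_def)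
  qed
  then show False
    using step[OF init] by (auto simp: chains_naa_def)
qed

lemma infinite_pigeonhole:
  assumes "infinite (I :: nat set)" "finite T" "\<And>n. n \<in> I \<Longrightarrow> \<exists>t\<in>T. P t n"
  shows "\<exists>t\<in>T. infinite {n. P t n}"
proof (rule ccontr)
  assume "\<not> ?thesis"
  then have "finite (\<Union>t\<in>T. {n. P t n})"
    using assms(2) by auto
  moreover have "I \<subseteq> (\<Union>t\<in>T. {n. P t n})"
    using assms(3) by auto
  ultimately show False
    using assms(1) finite_subset by blast
qed

lemma loop_in_dmts_impls:
  fixes D :: "(unit, 'q) dmts"
  assumes D: "is_dmts D" and chains: "\<And>n. chain (Suc n) \<in> dmts_impls D"
  shows "loop \<in> dmts_impls D"
proof -
  define P where "P d n \<longleftrightarrow> (\<exists>R. dmts_refinement (dmts_of_lts (chain 0)) D R \<and> (n, d) \<in> R)" for d n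
  have ref0: "dmts_refinement (dmts_of_lts (chain n)) D R
      = dmts_refinement (dmts_of_lts (chain 0)) D R" for n R
    by (simp add: dmts_refinement_def dmts_of_lts_def chain_def)
  have P_state: "d \<in> dmts_states D" if "P d n" for d n
    using that by (auto simp: P_def dmts_refinement_def)
  have P_may: "\<exists>t. (d, (), t) \<in> dmts_may D \<and> P t n" if "P d (Suc n)" for d n
  proof -
    from that obtain R where R: "dmts_refinement (dmts_of_lts (chain 0)) D R" "(Suc n, d) \<in> R"
      by (auto simp: P_def)
    moreover have "(Suc n, (), n) \<in> dmts_may (dmts_of_lts (chain 0))"
      by (auto simp: dmts_of_lts_def chain_def)
    ultimately have "\<exists>t. (d, (), t) \<in> dmts_may D \<and> (n, t) \<in> R"
      unfolding dmts_refinement_def by blast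
    then show ?thesis using R(1) by (auto simp: P_def)
  qed
  have P_must: "\<exists>t. ((), t) \<in> N \<and> P t n" if P: "P d (Suc n)" and N: "(d, N) \<in> dmts_must D" for d n N
  proof -
    from P obtain R where R: "dmts_refinement (dmts_of_lts (chain 0)) D R" "(Suc n, d) \<in> R"
      by (auto simp: P_def)
    then obtain N1 where "(Suc n, N1) \<in> dmts_must (dmts_of_lts (chain 0))"
      "\<forall>(a, t1)\<in>N1. \<exists>t2. (a, t2) \<in> N \<and> (t1, t2) \<in> R"
      using N unfolding dmts_refinement_def by blast
    then show ?thesis
      using R(1) by (auto simp: P_def dmts_of_lts_def chain_def)
  qed
  have fin: "finite {t. (d, (), t) \<in> dmts_may D}" if "d \<in> dmts_states D" for d
    using D that by (auto simp: is_dmts_def image_finite_def)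
  have inf_pred: "infinite {n. P d (Suc n)}" if "infinite {n. P d n}" for d
  proof
    assume "finite {n. P d (Suc n)}"
    then have "finite (insert 0 (Suc ` {n. P d (Suc n)}))" by simp
    moreover have "{n. P d n} \<subseteq> insert 0 (Suc ` {n. P d (Suc n)})"
    proof
      fix n assume "n \<in> {n. P d n}"
      then show "n \<in> insert 0 (Suc ` {n. P d (Suc n)})" by (cases n) auto
    qed
    ultimately show False using that finite_subset by blast
  qed
  have inf_state: "d \<in> dmts_states D" if "infinite {n. P d n}" for d
    using that P_state not_finite_existsD by blast
  define R where "R = {(0 :: nat, d) | d. infinite {n. P d n}}"
  have "dmts_refinement (dmts_of_lts loop) D R"
  proof -
    have may: "\<exists>t. (d, (), t) \<in> dmts_may D \<and> infinite {n. P t n}" if d: "infinite {n. P d n}" for d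
      using infinite_pigeonhole[OF inf_pred[OF d] fin[OF inf_state[OF d]], of P] P_may by auto
    have must: "\<exists>t. ((), t) \<in> N \<and> infinite {n. P t n}"
      if d: "infinite {n. P d n}" and N: "(d, N) \<in> dmts_must D" for d N
    proof -
      have "{t. ((), t) \<in> N} \<subseteq> {t. (d, (), t) \<in> dmts_may D}"
        using D N by (auto simp: is_dmts_def)
      then have "finite {t. ((), t) \<in> N}"
        using fin[OF inf_state[OF d]] finite_subset by blast
      from infinite_pigeonhole[OF inf_pred[OF d] this, of P] show ?thesis
        using P_must[OF _ N] by auto
    qed
    show ?thesis
      unfolding dmts_refinement_def
      using may must inf_state by (auto simp: R_def dmts_of_lts_def loop_def)
  qed
  moreover have "\<exists>d\<in>dmts_init D. (0, d) \<in> R"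
  proof -
    have ex: "\<exists>d\<in>dmts_init D. P d n" if "n \<in> range Suc" for n
    proof -
      from that obtain k where k: "n = Suc k" by blast
      have "dmts_init (dmts_of_lts (chain n)) = {n}"
        by (simp add: dmts_of_lts_def chain_def)
      then obtain R' d where "dmts_refinement (dmts_of_lts (chain n)) D R'"
        "d \<in> dmts_init D" "(n, d) \<in> R'"
        using chains[of k] unfolding dmts_impls_def dmts_refines_def k by auto
      then show ?thesis
        unfolding ref0[of n] P_def by blast
    qed
    have "infinite (range Suc)"
      by (simp add: finite_image_iff)
    moreover have "finite (dmts_init D)"
      using D by (simp add: is_dmts_def)
    ultimately have "\<exists>d\<in>dmts_init D. infinite {n. P d n}"
      using ex by (rule infinite_pigeonhole)
    then show ?thesis by (auto simp: R_def)
  qed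
  ultimately show ?thesis
    unfolding dmts_impls_def dmts_refines_def
    using is_lts_loop by (auto simp: dmts_of_lts_def loop_def)
qed

theorem chains_naa_not_dmts:
  "\<nexists>D :: (unit, 'q) dmts.
     is_dmts D \<and> dmts_impls D = (naa_impls chains_naa :: (unit, nat) lts set)"
proof
  assume "\<exists>D :: (unit, 'q) dmts.
     is_dmts D \<and> dmts_impls D = (naa_impls chains_naa :: (unit, nat) lts set)"
  then obtain D :: "(unit, 'q) dmts" where D: "is_dmts D"
    and eq: "dmts_impls D = (naa_impls chains_naa :: (unit, nat) lts set)"
    by blast
  have "loop \<in> dmts_impls D"
    by (rule loop_in_dmts_impls[OF D]) (simp only: eq chain_in_chains_naa)
  then show False
    using loop_notin_chains_naa by (simp only: eq)
qed

end

theory Submission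
  imports Defs
begin

text \<open>A disjunctive modal transition system becomes an acceptance automaton on the same states,
  whose acceptance sets are the sets of may transitions meeting every must. Conversely, the
  acceptance sets themselves serve as states: committing to one of them resolves the choice in the
  automaton. The declaration of a state in the nu-calculus is the disjunction of the characteristic
  formulas of its acceptance sets, so that post-fixed assignments and refinements are the same
  relations. For the way back no normal form is needed: the states are the Hintikka sets of
  subformulas, and their modal members determine the acceptance sets. Refinement being transitive,
  injective renaming of states does not change the implementations, which moves each construction
  into the prescribed infinite type.\<close>

section \<open>Matching of labelled states\<close>

definition matched :: "('p \<times> 'q) set \<Rightarrow> ('a \<times> 'p) set \<Rightarrow> ('a \<times> 'q) set \<Rightarrow> bool" where
  "matched R M N \<longleftrightarrow> (\<forall>(a, s)\<in>M. \<exists>t. (a, t) \<in> N \<and> (s, t) \<in> R)"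

definition bimatched :: "('p \<times> 'q) set \<Rightarrow> ('a \<times> 'p) set \<Rightarrow> ('a \<times> 'q) set \<Rightarrow> bool" where
  "bimatched R M N \<longleftrightarrow> matched R M N \<and> matched (R\<inverse>) N M"

lemma matchedI:
  "(\<And>a s. (a, s) \<in> M \<Longrightarrow> \<exists>t. (a, t) \<in> N \<and> (s, t) \<in> R) \<Longrightarrow> matched R M N"
  by (auto simp: matched_def)

lemma matchedE:
  assumes "matched R M N" "(a, s) \<in> M"
  obtains t where "(a, t) \<in> N" "(s, t) \<in> R"
  using assms by (auto simp: matched_def)

lemma matched_mono:
  "\<lbrakk>matched R M N; M' \<subseteq> M; N \<subseteq> N'\<rbrakk> \<Longrightarrow> matched R M' N'"
  by (fastforce simp: matched_def)

lemma matched_relcomp: "\<lbrakk>matched R M N; matched S N P\<rbrakk> \<Longrightarrow> matched (R O S) M P"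
  by (fastforce simp: matched_def)

lemma bimatched_relcomp: "\<lbrakk>bimatched R M N; bimatched S N P\<rbrakk> \<Longrightarrow> bimatched (R O S) M P"
  by (auto simp: bimatched_def converse_relcomp intro: matched_relcomp)

lemma bimatched_converse: "bimatched (R\<inverse>) M N \<longleftrightarrow> bimatched R N M"
  by (auto simp: bimatched_def)

lemma bimatched_image:
  assumes "M \<subseteq> UNIV \<times> S"
  shows "bimatched ((\<lambda>s. (s, e s)) ` S) M (map_prod id e ` M)"
  using assms by (force simp: bimatched_def matched_def)

section \<open>Refinement\<close>

lemma naa_refinement_iff:
  "naa_refinement A B R \<longleftrightarrow> R \<subseteq> naa_states A \<times> naa_states B
    \<and> (\<forall>(s, t)\<in>R. \<forall>M\<in>naa_tran A s. \<exists>N\<in>naa_tran B t. bimatched R M N)"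
  by (simp add: naa_refinement_def bimatched_def matched_def)

lemma dmts_refinement_iff:
  "dmts_refinement D E R \<longleftrightarrow> R \<subseteq> dmts_states D \<times> dmts_states E
    \<and> (\<forall>(s, t)\<in>R. matched R (dmts_may D `` {s}) (dmts_may E `` {t})
        \<and> (\<forall>N. (t, N) \<in> dmts_must E \<longrightarrow> (\<exists>M. (s, M) \<in> dmts_must D \<and> matched R M N)))"
  by (simp add: dmts_refinement_def matched_def Ball_def split_paired_All)

lemma naa_refinement_relcomp:
  assumes "naa_refinement A B R" "naa_refinement B C S"
  shows "naa_refinement A C (R O S)"
  using assms unfolding naa_refinement_iff
  by (fastforce intro: bimatched_relcomp)

lemma dmts_refinement_relcomp:
  assumes "dmts_refinement D E R" "dmts_refinement E G S"
  shows "dmts_refinement D G (R O S)"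
  using assms unfolding dmts_refinement_iff
  by (fastforce intro: matched_relcomp)

lemma naa_refines_trans: "\<lbrakk>naa_refines A B; naa_refines B C\<rbrakk> \<Longrightarrow> naa_refines A C"
  unfolding naa_refines_def by (meson naa_refinement_relcomp relcomp.relcompI)

lemma dmts_refines_trans: "\<lbrakk>dmts_refines D E; dmts_refines E G\<rbrakk> \<Longrightarrow> dmts_refines D G"
  unfolding dmts_refines_def by (meson dmts_refinement_relcomp relcomp.relcompI)

lemma naa_impls_mono: "naa_refines A B \<Longrightarrow> naa_impls A \<subseteq> naa_impls B"
  by (auto simp: naa_impls_def intro: naa_refines_trans)

lemma dmts_impls_mono: "dmts_refines D E \<Longrightarrow> dmts_impls D \<subseteq> dmts_impls E"
  by (auto simp: dmts_impls_def intro: dmts_refines_trans)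

lemma naa_refinement_lts_iff:
  "naa_refinement (naa_of_lts L) A R \<longleftrightarrow> R \<subseteq> lts_states L \<times> naa_states A
    \<and> (\<forall>(i, s)\<in>R. \<exists>M\<in>naa_tran A s. bimatched R (lts_trans L `` {i}) M)"
proof -
  have "naa_states (naa_of_lts L) = lts_states L"
    and "naa_tran (naa_of_lts L) i = {lts_trans L `` {i}}" for i
    by (auto simp: naa_of_lts_def)
  then show ?thesis
    by (simp add: naa_refinement_iff)
qed

lemma dmts_refinement_lts_iff:
  "dmts_refinement (dmts_of_lts L) D R \<longleftrightarrow> R \<subseteq> lts_states L \<times> dmts_states D
    \<and> (\<forall>(i, s)\<in>R. matched R (lts_trans L `` {i}) (dmts_may D `` {s})
        \<and> (\<forall>N. (s, N) \<in> dmts_must D \<longrightarrow> (\<exists>p\<in>lts_trans L `` {i}. matched R {p} N)))"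
proof -
  have "(\<exists>M. (i, M) \<in> dmts_must (dmts_of_lts L) \<and> matched R M N)
      \<longleftrightarrow> (\<exists>p\<in>lts_trans L `` {i}. matched R {p} N)" for i N
    by (auto simp: dmts_of_lts_def)
  then show ?thesis
    by (simp add: dmts_refinement_iff) (simp add: dmts_of_lts_def)
qed

lemma naa_impls_iff:
  "L \<in> naa_impls A \<longleftrightarrow> is_lts L \<and>
    (\<exists>R. naa_refinement (naa_of_lts L) A R \<and> (\<exists>s\<in>naa_init A. (lts_init L, s) \<in> R))"
  by (simp add: naa_impls_def naa_refines_def naa_of_lts_def)

lemma dmts_impls_iff:
  "L \<in> dmts_impls D \<longleftrightarrow> is_lts L \<and>
    (\<exists>R. dmts_refinement (dmts_of_lts L) D R \<and> (\<exists>s\<in>dmts_init D. (lts_init L, s) \<in> R))"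
  by (simp add: dmts_impls_def dmts_refines_def dmts_of_lts_def)

lemma nuhml_impls_iff:
  "L \<in> nuhml_impls F \<longleftrightarrow> is_lts L \<and>
    (\<exists>\<sigma>. nu_postfixed L F \<sigma> \<and> (\<exists>x\<in>nu_init F. lts_init L \<in> \<sigma> x))"
  using nu_sem_greatest[of L F] by (fastforce simp: nuhml_impls_def le_fun_def)

section \<open>Renaming of states\<close>

definition naa_image :: "('p \<Rightarrow> 'q) \<Rightarrow> ('a, 'p) naa \<Rightarrow> ('a, 'q) naa" where
  "naa_image e A = \<lparr>naa_states = e ` naa_states A, naa_init = e ` naa_init A,
     naa_tran = (\<lambda>q. {map_prod id e ` M | M s. s \<in> naa_states A \<and> q = e s \<and> M \<in> naa_tran A s})\<rparr>"

definition dmts_image :: "('p \<Rightarrow> 'q) \<Rightarrow> ('a, 'p) dmts \<Rightarrow> ('a, 'q) dmts" where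
  "dmts_image e D = \<lparr>dmts_states = e ` dmts_states D, dmts_init = e ` dmts_init D,
     dmts_may = {(e s, a, e t) | s a t. (s, a, t) \<in> dmts_may D},
     dmts_must = {(e s, map_prod id e ` N) | s N. (s, N) \<in> dmts_must D}\<rparr>"

lemma naa_tranD:
  "\<lbrakk>is_naa A; s \<in> naa_states A; M \<in> naa_tran A s\<rbrakk> \<Longrightarrow> finite M \<and> M \<subseteq> UNIV \<times> naa_states A"
  by (auto simp: is_naa_def Fpow_def)

lemma is_naa_naa_image: "is_naa A \<Longrightarrow> is_naa (naa_image e A)"
  by (fastforce simp: is_naa_def naa_image_def Fpow_def)

lemma naa_impls_naa_image:
  assumes A: "is_naa A" and e: "inj_on e (naa_states A)"
  shows "naa_impls (naa_image e A) = naa_impls A"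
proof (rule subset_antisym)
  let ?graph = "(\<lambda>s. (s, e s)) ` naa_states A"
  have states: "e s \<in> naa_states (naa_image e A)" if "s \<in> naa_states A" for s
    using that by (simp add: naa_image_def)
  have bimatched: "bimatched ?graph M (map_prod id e ` M)"
    if "s \<in> naa_states A" "M \<in> naa_tran A s" for s M
    using naa_tranD[OF A that] by (simp add: bimatched_image)
  have tran: "naa_tran (naa_image e A) (e s) = (`) (map_prod id e) ` naa_tran A s"
    if "s \<in> naa_states A" for s
    using that e by (auto simp: naa_image_def dest: inj_onD)
  have init: "naa_init (naa_image e A) = e ` naa_init A" "naa_init A \<subseteq> naa_states A"
    using A by (simp_all add: naa_image_def is_naa_def)
  have "naa_refinement A (naa_image e A) ?graph"
    using bimatched by (auto simp: naa_refinement_iff tran states)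
  then have "naa_refines A (naa_image e A)"
    unfolding naa_refines_def using init by (intro exI[of _ ?graph]) auto
  then show "naa_impls A \<subseteq> naa_impls (naa_image e A)"
    by (rule naa_impls_mono)
  have "naa_refinement (naa_image e A) A (?graph\<inverse>)"
    using bimatched by (auto simp: naa_refinement_iff tran states bimatched_converse) blast
  then have "naa_refines (naa_image e A) A"
    unfolding naa_refines_def using init by (intro exI[of _ "?graph\<inverse>"]) auto
  then show "naa_impls (naa_image e A) \<subseteq> naa_impls A"
    by (rule naa_impls_mono)
qed

lemma dmts_may_dmts_image:
  assumes "is_dmts D" "inj_on e (dmts_states D)" "s \<in> dmts_states D"
  shows "dmts_may (dmts_image e D) `` {e s} = map_prod id e ` (dmts_may D `` {s})"
proof -
  have "dmts_may D \<subseteq> dmts_states D \<times> UNIV"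
    using assms(1) by (auto simp: is_dmts_def)
  then show ?thesis
    using assms(2,3) by (force simp: dmts_image_def dest: inj_onD)
qed

lemma dmts_must_dmts_image_iff:
  assumes "is_dmts D" "inj_on e (dmts_states D)" "s \<in> dmts_states D"
  shows "(e s, N') \<in> dmts_must (dmts_image e D)
    \<longleftrightarrow> (\<exists>N. (s, N) \<in> dmts_must D \<and> N' = map_prod id e ` N)"
proof -
  have "e s = e s' \<longleftrightarrow> s = s'" if "(s', N) \<in> dmts_must D" for s' N
    using assms that by (auto simp: is_dmts_def inj_on_eq_iff)
  then show ?thesis
    by (auto simp: dmts_image_def)
qed

lemma is_dmts_dmts_image:
  assumes D: "is_dmts D" and e: "inj_on e (dmts_states D)"
  shows "is_dmts (dmts_image e D)"
proof -
  let ?E = "dmts_image e D"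
  have "finite {t. (e s, a, t) \<in> dmts_may ?E}" if s: "s \<in> dmts_states D" for s a
  proof -
    have "{t. (e s, a, t) \<in> dmts_may ?E} = (map_prod id e ` (dmts_may D `` {s})) `` {a}"
      by (auto simp flip: dmts_may_dmts_image[OF D e s])
    also have "\<dots> = e ` {t. (s, a, t) \<in> dmts_may D}"
      by force
    finally show ?thesis
      using D s by (simp add: is_dmts_def image_finite_def)
  qed
  then have "image_finite (dmts_states ?E) (dmts_may ?E)"
    by (auto simp: image_finite_def dmts_image_def)
  moreover have "dmts_init ?E \<subseteq> dmts_states ?E \<and> finite (dmts_init ?E)"
    using D by (auto simp: is_dmts_def dmts_image_def)
  moreover have "dmts_may ?E \<subseteq> dmts_states ?E \<times> UNIV \<times> dmts_states ?E"
    using D by (auto simp: is_dmts_def dmts_image_def)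
  moreover have "dmts_must ?E \<subseteq> dmts_states ?E \<times> Pow (UNIV \<times> dmts_states ?E)"
    using D by (fastforce simp: is_dmts_def dmts_image_def)
  moreover have "(s, a, t) \<in> dmts_may ?E" if "(s, N) \<in> dmts_must ?E" "(a, t) \<in> N" for s N a t
    using D that by (auto simp: is_dmts_def dmts_image_def) blast
  ultimately show ?thesis
    unfolding is_dmts_def by blast
qed

lemma dmts_impls_dmts_image:
  assumes D: "is_dmts D" and e: "inj_on e (dmts_states D)"
  shows "dmts_impls (dmts_image e D) = dmts_impls D"
proof (rule subset_antisym)
  let ?graph = "(\<lambda>s. (s, e s)) ` dmts_states D"
  note image = dmts_may_dmts_image[OF D e] dmts_must_dmts_image_iff[OF D e]
  have states: "e s \<in> dmts_states (dmts_image e D)" if "s \<in> dmts_states D" for s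
    using that by (simp add: dmts_image_def)
  have init: "dmts_init (dmts_image e D) = e ` dmts_init D" "dmts_init D \<subseteq> dmts_states D"
    using D by (simp_all add: dmts_image_def is_dmts_def)
  have may: "bimatched ?graph (dmts_may D `` {s}) (map_prod id e ` (dmts_may D `` {s}))" for s
    using D by (intro bimatched_image) (auto simp: is_dmts_def)
  have must: "bimatched ?graph N (map_prod id e ` N)" if "(s, N) \<in> dmts_must D" for s N
    using D that by (intro bimatched_image) (auto simp: is_dmts_def)
  have "dmts_refinement D (dmts_image e D) ?graph"
    using may must by (auto simp: dmts_refinement_iff image states bimatched_def)
  then have "dmts_refines D (dmts_image e D)"
    unfolding dmts_refines_def using init by (intro exI[of _ ?graph]) auto
  then show "dmts_impls D \<subseteq> dmts_impls (dmts_image e D)"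
    by (rule dmts_impls_mono)
  have "dmts_refinement (dmts_image e D) D (?graph\<inverse>)"
    using may must by (auto simp: dmts_refinement_iff image states bimatched_def) blast
  then have "dmts_refines (dmts_image e D) D"
    unfolding dmts_refines_def using init by (intro exI[of _ "?graph\<inverse>"]) auto
  then show "dmts_impls (dmts_image e D) \<subseteq> dmts_impls D"
    by (rule dmts_impls_mono)
qed

section \<open>From disjunctive modal transition systems to acceptance automata\<close>

definition naa_of_dmts :: "('a, 'q) dmts \<Rightarrow> ('a, 'q) naa" where
  "naa_of_dmts D = \<lparr>naa_states = dmts_states D, naa_init = dmts_init D,
     naa_tran = (\<lambda>s. {M. M \<subseteq> dmts_may D `` {s} \<and> (\<forall>N. (s, N) \<in> dmts_must D \<longrightarrow> N \<inter> M \<noteq> {})})\<rparr>"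

lemma image_finite_imp_finite_Image:
  fixes T :: "('s \<times> 'a::finite \<times> 's) set"
  assumes "image_finite S T" "s \<in> S"
  shows "finite (T `` {s})"
proof -
  have "T `` {s} = (SIGMA a:UNIV. {t. (s, a, t) \<in> T})"
    by auto
  then show ?thesis
    using assms by (simp add: image_finite_def)
qed

lemma finite_dmts_may:
  fixes D :: "('a::finite, 'q) dmts"
  assumes "is_dmts D" "s \<in> dmts_states D"
  shows "finite (dmts_may D `` {s})"
  using assms by (auto simp: is_dmts_def intro: image_finite_imp_finite_Image)

lemma is_naa_naa_of_dmts:
  fixes D :: "('a::finite, 'q) dmts"
  assumes "is_dmts D"
  shows "is_naa (naa_of_dmts D)"
proof -
  have "M \<in> Fpow (UNIV \<times> dmts_states D)"
    if "s \<in> dmts_states D" "M \<subseteq> dmts_may D `` {s}" for s M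
    using that assms finite_subset[OF that(2) finite_dmts_may[OF assms that(1)]]
    by (auto simp: Fpow_def is_dmts_def)
  then show ?thesis
    using assms by (auto simp: is_naa_def naa_of_dmts_def is_dmts_def)
qed

lemma naa_locally_finite_naa_of_dmts:
  fixes D :: "('a::finite, 'q) dmts"
  assumes "is_dmts D"
  shows "naa_locally_finite (naa_of_dmts D)"
proof -
  have "finite (naa_tran (naa_of_dmts D) s)" if "s \<in> dmts_states D" for s
    by (rule finite_subset[of _ "Pow (dmts_may D `` {s})"])
      (auto simp: naa_of_dmts_def finite_dmts_may[OF assms that])
  then show ?thesis
    by (simp add: naa_locally_finite_def naa_of_dmts_def)
qed

lemma ex_bimatched_hitting_set_iff:
  assumes "\<And>N. N \<in> \<N> \<Longrightarrow> N \<subseteq> Y"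
  shows "(\<exists>M\<subseteq>Y. (\<forall>N\<in>\<N>. N \<inter> M \<noteq> {}) \<and> bimatched R X M)
    \<longleftrightarrow> matched R X Y \<and> (\<forall>N\<in>\<N>. \<exists>p\<in>X. matched R {p} N)"
proof (intro iffI conjI ballI)
  assume "\<exists>M\<subseteq>Y. (\<forall>N\<in>\<N>. N \<inter> M \<noteq> {}) \<and> bimatched R X M"
  then obtain M where M: "M \<subseteq> Y" "\<forall>N\<in>\<N>. N \<inter> M \<noteq> {}"
    and match: "matched R X M" "matched (R\<inverse>) M X"
    by (auto simp: bimatched_def)
  show "matched R X Y"
    using match(1) M(1) by (rule matched_mono[OF _ subset_refl])
  show "\<exists>p\<in>X. matched R {p} N" if "N \<in> \<N>" for N
  proof -
    from M(2) that have "N \<inter> M \<noteq> {}"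
      by blast
    then obtain a t where "(a, t) \<in> N" "(a, t) \<in> M"
      by auto
    from match(2) this(2) obtain j where "(a, j) \<in> X" "(t, j) \<in> R\<inverse>"
      by (rule matchedE)
    with \<open>(a, t) \<in> N\<close> show ?thesis
      by (intro bexI[of _ "(a, j)"]) (auto simp: matched_def)
  qed
next
  assume X: "matched R X Y \<and> (\<forall>N\<in>\<N>. \<exists>p\<in>X. matched R {p} N)"
  define M where "M = {q \<in> Y. matched (R\<inverse>) {q} X}"
  have "bimatched R X M"
    using X unfolding M_def bimatched_def matched_def by auto blast+
  moreover have "N \<inter> M \<noteq> {}" if "N \<in> \<N>" for N
  proof -
    from X that obtain p where "p \<in> X" "matched R {p} N"
      by blast
    then show ?thesis
      using assms[OF that] unfolding M_def matched_def by auto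
  qed
  ultimately show "\<exists>M\<subseteq>Y. (\<forall>N\<in>\<N>. N \<inter> M \<noteq> {}) \<and> bimatched R X M"
    by (intro exI[of _ M]) (auto simp: M_def)
qed

lemma naa_refinement_naa_of_dmts_iff:
  assumes "is_dmts D"
  shows "naa_refinement (naa_of_lts L) (naa_of_dmts D) R \<longleftrightarrow> dmts_refinement (dmts_of_lts L) D R"
proof -
  have "N \<subseteq> dmts_may D `` {s}" if "N \<in> dmts_must D `` {s}" for s N
    using assms that by (auto simp: is_dmts_def)
  note ex_bimatched_hitting_set_iff[of "dmts_must D `` {_}", OF this]
  then have "(\<exists>M\<in>naa_tran (naa_of_dmts D) s. bimatched R X M)
    \<longleftrightarrow> matched R X (dmts_may D `` {s}) \<and> (\<forall>N. (s, N) \<in> dmts_must D \<longrightarrow> (\<exists>p\<in>X. matched R {p} N))"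
    for s X
    by (simp add: naa_of_dmts_def Bex_def Ball_def conj_assoc)
  moreover have "naa_states (naa_of_dmts D) = dmts_states D"
    by (simp add: naa_of_dmts_def)
  ultimately show ?thesis
    by (simp only: naa_refinement_lts_iff dmts_refinement_lts_iff)
qed

lemma naa_impls_naa_of_dmts:
  assumes "is_dmts D"
  shows "naa_impls (naa_of_dmts D) = dmts_impls D"
proof -
  have "naa_init (naa_of_dmts D) = dmts_init D"
    by (simp add: naa_of_dmts_def)
  then show ?thesis
    by (auto simp: naa_impls_iff dmts_impls_iff naa_refinement_naa_of_dmts_iff[OF assms])
qed

section \<open>From acceptance automata to disjunctive modal transition systems\<close>

definition acceptance_sets :: "('a, 'q) naa \<Rightarrow> ('a \<times> 'q) set set" where
  "acceptance_sets A = (\<Union>s\<in>naa_states A. naa_tran A s)"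

definition dmts_of_naa :: "('a, 'q) naa \<Rightarrow> ('a, ('a \<times> 'q) set) dmts" where
  "dmts_of_naa A = \<lparr>dmts_states = acceptance_sets A,
     dmts_init = (\<Union>s\<in>naa_init A. naa_tran A s),
     dmts_may = {(M, a, M') | M a t M'.
       M \<in> acceptance_sets A \<and> (a, t) \<in> M \<and> M' \<in> naa_tran A t},
     dmts_must = {(M, {a} \<times> naa_tran A t) | M a t. M \<in> acceptance_sets A \<and> (a, t) \<in> M}\<rparr>"

lemma acceptance_sets_target:
  "\<lbrakk>is_naa A; M \<in> acceptance_sets A; (a, t) \<in> M\<rbrakk> \<Longrightarrow> t \<in> naa_states A"
  by (auto simp: acceptance_sets_def dest: naa_tranD)

lemma is_dmts_dmts_of_naa:
  assumes A: "is_naa A" and fin: "naa_locally_finite A"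
  shows "is_dmts (dmts_of_naa A)"
proof -
  let ?D = "dmts_of_naa A"
  have "finite {M'. (M, a, M') \<in> dmts_may ?D}" if M: "M \<in> acceptance_sets A" for M a
  proof (rule finite_subset)
    show "{M'. (M, a, M') \<in> dmts_may ?D} \<subseteq> (\<Union>p\<in>M. naa_tran A (snd p))"
      by (force simp: dmts_of_naa_def)
    have "finite M"
      using M by (auto simp: acceptance_sets_def dest: naa_tranD[OF A])
    moreover have "finite (naa_tran A (snd p))" if "p \<in> M" for p
      using fin acceptance_sets_target[OF A M, of "fst p" "snd p"] that
      by (simp add: naa_locally_finite_def)
    ultimately show "finite (\<Union>p\<in>M. naa_tran A (snd p))"
      by blast
  qed
  then have "image_finite (dmts_states ?D) (dmts_may ?D)"
    by (simp add: image_finite_def dmts_of_naa_def)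
  moreover have "dmts_init ?D \<subseteq> dmts_states ?D" "finite (dmts_init ?D)"
    using A fin
    by (auto simp: is_naa_def dmts_of_naa_def acceptance_sets_def naa_locally_finite_def)
  moreover have "M' \<in> acceptance_sets A"
    if "M \<in> acceptance_sets A" "(a, t) \<in> M" "M' \<in> naa_tran A t" for M a t M'
    using acceptance_sets_target[OF A that(1,2)] that(3) by (auto simp: acceptance_sets_def)
  ultimately show ?thesis
    unfolding is_dmts_def by (auto simp: dmts_of_naa_def)
qed

definition commitments ::
  "('a, 's) lts \<Rightarrow> ('a, 'q) naa \<Rightarrow> ('s \<times> 'q) set \<Rightarrow> ('s \<times> ('a \<times> 'q) set) set" where
  "commitments L A R =
     {(i, M). \<exists>s. (i, s) \<in> R \<and> M \<in> naa_tran A s \<and> bimatched R (lts_trans L `` {i}) M}"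

lemma ex_commitment:
  assumes "naa_refinement (naa_of_lts L) A R" "(i, s) \<in> R"
  obtains M where "M \<in> naa_tran A s" "(i, M) \<in> commitments L A R"
  using assms unfolding naa_refinement_lts_iff commitments_def by blast

lemma commitmentsD:
  assumes "naa_refinement (naa_of_lts L) A R" "(i, M) \<in> commitments L A R"
  shows "i \<in> lts_states L" "M \<in> acceptance_sets A" "bimatched R (lts_trans L `` {i}) M"
  using assms by (auto simp: commitments_def acceptance_sets_def naa_refinement_lts_iff)

lemma matched_may_commitments:
  assumes R: "naa_refinement (naa_of_lts L) A R" and iM: "(i, M) \<in> commitments L A R"
  shows "matched (commitments L A R) (lts_trans L `` {i}) (dmts_may (dmts_of_naa A) `` {M})"
proof (rule matchedI)
  fix a j
  assume step: "(a, j) \<in> lts_trans L `` {i}"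
  have "matched R (lts_trans L `` {i}) M"
    using commitmentsD(3)[OF R iM] by (simp add: bimatched_def)
  from this step obtain t where t: "(a, t) \<in> M" and "(j, t) \<in> R"
    by (rule matchedE)
  from R this(2) obtain M' where "M' \<in> naa_tran A t" "(j, M') \<in> commitments L A R"
    by (rule ex_commitment)
  then show "\<exists>M'. (a, M') \<in> dmts_may (dmts_of_naa A) `` {M} \<and> (j, M') \<in> commitments L A R"
    using t commitmentsD(2)[OF R iM] by (auto simp: dmts_of_naa_def)
qed

lemma matched_must_commitments:
  assumes R: "naa_refinement (naa_of_lts L) A R" and iM: "(i, M) \<in> commitments L A R"
    and must: "(M, N) \<in> dmts_must (dmts_of_naa A)"
  shows "\<exists>p\<in>lts_trans L `` {i}. matched (commitments L A R) {p} N"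
proof -
  obtain a t where t: "(a, t) \<in> M" and N: "N = {a} \<times> naa_tran A t"
    using must by (auto simp: dmts_of_naa_def)
  have "matched (R\<inverse>) M (lts_trans L `` {i})"
    using commitmentsD(3)[OF R iM] by (simp add: bimatched_def)
  from this t obtain j where j: "(a, j) \<in> lts_trans L `` {i}" and "(t, j) \<in> R\<inverse>"
    by (rule matchedE)
  from this(2) have "(j, t) \<in> R"
    by simp
  with R obtain M' where "M' \<in> naa_tran A t" "(j, M') \<in> commitments L A R"
    by (rule ex_commitment)
  then have "matched (commitments L A R) {(a, j)} N"
    by (auto simp: N matched_def)
  with j show ?thesis
    by (rule rev_bexI)
qed

lemma dmts_refinement_commitments:
  assumes R: "naa_refinement (naa_of_lts L) A R"
  shows "dmts_refinement (dmts_of_lts L) (dmts_of_naa A) (commitments L A R)"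
proof -
  have "commitments L A R \<subseteq> lts_states L \<times> dmts_states (dmts_of_naa A)"
    using commitmentsD(1,2)[OF R] by (auto simp: dmts_of_naa_def)
  then show ?thesis
    unfolding dmts_refinement_lts_iff
    using matched_may_commitments[OF R] matched_must_commitments[OF R] by blast
qed

lemma naa_refinement_dmts_of_naa:
  assumes A: "is_naa A" and R: "dmts_refinement (dmts_of_lts L) (dmts_of_naa A) R"
  shows "naa_refinement (naa_of_lts L) A
    {(i, s). s \<in> naa_states A \<and> (\<exists>M\<in>naa_tran A s. (i, M) \<in> R)}"
    (is "naa_refinement _ _ ?R")
proof -
  let ?D = "dmts_of_naa A"
  have "bimatched ?R (lts_trans L `` {i}) M" if iM: "(i, M) \<in> R" for i M
    unfolding bimatched_def
  proof (intro conjI matchedI)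
    have M: "M \<in> acceptance_sets A"
      using R iM by (auto simp: dmts_refinement_lts_iff dmts_of_naa_def)
    have may: "matched R (lts_trans L `` {i}) (dmts_may ?D `` {M})"
      and must: "\<And>N. (M, N) \<in> dmts_must ?D \<Longrightarrow> \<exists>p\<in>lts_trans L `` {i}. matched R {p} N"
      using R iM by (auto simp: dmts_refinement_lts_iff)
    show "\<exists>t. (a, t) \<in> M \<and> (j, t) \<in> ?R"
      if step: "(a, j) \<in> lts_trans L `` {i}" for a j
    proof -
      from may step obtain M' where "(a, M') \<in> dmts_may ?D `` {M}" "(j, M') \<in> R"
        by (rule matchedE)
      then show ?thesis
        using acceptance_sets_target[OF A M] by (auto simp: dmts_of_naa_def)
    qed
    show "\<exists>j. (a, j) \<in> lts_trans L `` {i} \<and> (t, j) \<in> ?R\<inverse>" if t: "(a, t) \<in> M" for a t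
    proof -
      have "(M, {a} \<times> naa_tran A t) \<in> dmts_must ?D"
        using M t by (auto simp: dmts_of_naa_def)
      from must[OF this] show ?thesis
        using acceptance_sets_target[OF A M t] by (auto simp: matched_def)
    qed
  qed
  moreover have "?R \<subseteq> lts_states L \<times> naa_states A"
    using R by (auto simp: dmts_refinement_lts_iff)
  ultimately show ?thesis
    unfolding naa_refinement_lts_iff by blast
qed

lemma dmts_impls_dmts_of_naa:
  assumes A: "is_naa A"
  shows "dmts_impls (dmts_of_naa A) = naa_impls A"
proof (intro Set.set_eqI iffI)
  fix L :: "('a, 's) lts"
  assume "L \<in> naa_impls A"
  then obtain R s where L: "is_lts L" and R: "naa_refinement (naa_of_lts L) A R"
    and s: "s \<in> naa_init A" "(lts_init L, s) \<in> R"
    by (auto simp: naa_impls_iff)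
  from R s(2) obtain M where "M \<in> naa_tran A s" "(lts_init L, M) \<in> commitments L A R"
    by (rule ex_commitment)
  moreover from this(1) s(1) have "M \<in> dmts_init (dmts_of_naa A)"
    by (auto simp: dmts_of_naa_def)
  ultimately show "L \<in> dmts_impls (dmts_of_naa A)"
    unfolding dmts_impls_iff using L dmts_refinement_commitments[OF R] by blast
next
  fix L :: "('a, 's) lts"
  assume "L \<in> dmts_impls (dmts_of_naa A)"
  then obtain R M where L: "is_lts L" and R: "dmts_refinement (dmts_of_lts L) (dmts_of_naa A) R"
    and M: "M \<in> dmts_init (dmts_of_naa A)" "(lts_init L, M) \<in> R"
    by (auto simp: dmts_impls_iff)
  obtain s where "s \<in> naa_init A" "s \<in> naa_states A" "M \<in> naa_tran A s"
    using A M(1) by (auto simp: dmts_of_naa_def is_naa_def)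
  then show "L \<in> naa_impls A"
    unfolding naa_impls_iff using L M(2) naa_refinement_dmts_of_naa[OF A R] by blast
qed

section \<open>From acceptance automata to the nu-calculus\<close>

text \<open>The formulas \<open>Conj \<Phi>\<close> and \<open>Disj \<Phi>\<close> are meaningful for finite \<open>\<Phi>\<close> only; otherwise the list
  chosen is arbitrary.\<close>

definition Conj :: "('a, 'x) hml set \<Rightarrow> ('a, 'x) hml" where
  "Conj \<Phi> = foldr And (SOME \<phi>s. set \<phi>s = \<Phi>) TT"

definition Disj :: "('a, 'x) hml set \<Rightarrow> ('a, 'x) hml" where
  "Disj \<Phi> = foldr Or (SOME \<phi>s. set \<phi>s = \<Phi>) FF"

lemma
  assumes "finite \<Phi>"
  shows hml_sem_Conj: "hml_sem L (Conj \<Phi>) \<sigma> = lts_states L \<inter> (\<Inter>\<phi>\<in>\<Phi>. hml_sem L \<phi> \<sigma>)"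
    and vars_Conj: "vars (Conj \<Phi>) = (\<Union>\<phi>\<in>\<Phi>. vars \<phi>)"
proof -
  have "hml_sem L (foldr And \<phi>s TT) \<sigma> = lts_states L \<inter> (\<Inter>\<phi>\<in>set \<phi>s. hml_sem L \<phi> \<sigma>)"
    and "vars (foldr And \<phi>s TT) = (\<Union>\<phi>\<in>set \<phi>s. vars \<phi>)" for \<phi>s
    by (induction \<phi>s) auto
  then show "hml_sem L (Conj \<Phi>) \<sigma> = lts_states L \<inter> (\<Inter>\<phi>\<in>\<Phi>. hml_sem L \<phi> \<sigma>)"
    and "vars (Conj \<Phi>) = (\<Union>\<phi>\<in>\<Phi>. vars \<phi>)"
    using someI_ex[OF finite_list[OF assms]] by (simp_all add: Conj_def)
qed

lemma
  assumes "finite \<Phi>"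
  shows hml_sem_Disj: "hml_sem L (Disj \<Phi>) \<sigma> = (\<Union>\<phi>\<in>\<Phi>. hml_sem L \<phi> \<sigma>)"
    and vars_Disj: "vars (Disj \<Phi>) = (\<Union>\<phi>\<in>\<Phi>. vars \<phi>)"
proof -
  have "hml_sem L (foldr Or \<phi>s FF) \<sigma> = (\<Union>\<phi>\<in>set \<phi>s. hml_sem L \<phi> \<sigma>)"
    and "vars (foldr Or \<phi>s FF) = (\<Union>\<phi>\<in>set \<phi>s. vars \<phi>)" for \<phi>s
    by (induction \<phi>s) auto
  then show "hml_sem L (Disj \<Phi>) \<sigma> = (\<Union>\<phi>\<in>\<Phi>. hml_sem L \<phi> \<sigma>)"
    and "vars (Disj \<Phi>) = (\<Union>\<phi>\<in>\<Phi>. vars \<phi>)"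
    using someI_ex[OF finite_list[OF assms]] by (simp_all add: Disj_def)
qed

definition acceptance_formula :: "('a \<times> 'x) set \<Rightarrow> ('a, 'x) hml" where
  "acceptance_formula M =
     And (Conj ((\<lambda>(a, x). Dia a (Var x)) ` M)) (Conj (range (\<lambda>a. Box a (Disj (Var ` (M `` {a}))))))"

lemma hml_sem_acceptance_formula:
  fixes M :: "('a::finite \<times> 'x) set"
  assumes "finite M"
  shows "i \<in> hml_sem L (acceptance_formula M) \<sigma> \<longleftrightarrow>
    i \<in> lts_states L \<and> bimatched {(i, x). i \<in> \<sigma> x} (lts_trans L `` {i}) M"
proof -
  let ?R = "{(i, x). i \<in> \<sigma> x}"
  have "i \<in> hml_sem L (Conj ((\<lambda>(a, x). Dia a (Var x)) ` M)) \<sigma>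
      \<longleftrightarrow> i \<in> lts_states L \<and> matched (?R\<inverse>) M (lts_trans L `` {i})"
    using assms by (auto simp: hml_sem_Conj matched_def)
  moreover have "i \<in> hml_sem L (Conj (range (\<lambda>a. Box a (Disj (Var ` (M `` {a})))))) \<sigma>
      \<longleftrightarrow> i \<in> lts_states L \<and> matched ?R (lts_trans L `` {i}) M"
    using assms by (auto simp: hml_sem_Conj hml_sem_Disj finite_Image matched_def) blast+
  ultimately show ?thesis
    by (auto simp: acceptance_formula_def bimatched_def)
qed

lemma vars_acceptance_formula:
  fixes M :: "('a::finite \<times> 'x) set"
  assumes "finite M"
  shows "vars (acceptance_formula M) = snd ` M"
  using assms by (force simp: acceptance_formula_def vars_Conj vars_Disj finite_Image)

definition nuhml_of_naa :: "('a, 'x) naa \<Rightarrow> ('a, 'x) nuhml" where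
  "nuhml_of_naa A = \<lparr>nu_vars = naa_states A, nu_init = naa_init A,
     nu_decl = (\<lambda>x. Disj (acceptance_formula ` naa_tran A x))\<rparr>"

context
  fixes A :: "('a::finite, 'x) naa"
  assumes A: "is_naa A" and fin: "finite (naa_states A)"
begin

lemma finite_naa_tran: "s \<in> naa_states A \<Longrightarrow> finite (naa_tran A s)"
  using finite_naa_locally_finite[OF A fin] by (simp add: naa_locally_finite_def)

lemma is_nuhml_nuhml_of_naa: "is_nuhml (nuhml_of_naa A)"
proof -
  have "vars (nu_decl (nuhml_of_naa A) s) \<subseteq> naa_states A" if s: "s \<in> naa_states A" for s
    using naa_tranD[OF A s]
    by (fastforce simp: nuhml_of_naa_def vars_Disj finite_naa_tran[OF s] vars_acceptance_formula)
  then show ?thesis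
    using A fin by (simp add: is_nuhml_def is_naa_def nuhml_of_naa_def)
qed

lemma hml_sem_nu_decl_nuhml_of_naa:
  assumes s: "s \<in> naa_states A"
  shows "i \<in> hml_sem L (nu_decl (nuhml_of_naa A) s) \<sigma> \<longleftrightarrow> i \<in> lts_states L
    \<and> (\<exists>M\<in>naa_tran A s. bimatched {(i, x). i \<in> \<sigma> x} (lts_trans L `` {i}) M)"
  using naa_tranD[OF A s]
  by (auto simp: nuhml_of_naa_def hml_sem_Disj finite_naa_tran[OF s] hml_sem_acceptance_formula)

lemma nu_postfixed_nuhml_of_naa_iff:
  "nu_postfixed L (nuhml_of_naa A) \<sigma> \<longleftrightarrow> naa_refinement (naa_of_lts L) A {(i, x). i \<in> \<sigma> x}"
proof -
  have nu_vars: "nu_vars (nuhml_of_naa A) = naa_states A"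
    by (simp add: nuhml_of_naa_def)
  have "nu_assignment L (nuhml_of_naa A) \<sigma>
      \<longleftrightarrow> {(i, x). i \<in> \<sigma> x} \<subseteq> lts_states L \<times> naa_states A"
    unfolding nu_assignment_def nu_vars by blast
  then show ?thesis
    unfolding nu_postfixed_def naa_refinement_lts_iff nu_vars
    using hml_sem_nu_decl_nuhml_of_naa by fastforce
qed

lemma nuhml_impls_nuhml_of_naa: "nuhml_impls (nuhml_of_naa A) = naa_impls A"
proof (rule Set.set_eqI)
  fix L :: "('a, 's) lts"
  have "(\<exists>\<sigma>. nu_postfixed L (nuhml_of_naa A) \<sigma> \<and> (\<exists>x\<in>naa_init A. lts_init L \<in> \<sigma> x))
      \<longleftrightarrow> (\<exists>R. naa_refinement (naa_of_lts L) A R \<and> (\<exists>x\<in>naa_init A. (lts_init L, x) \<in> R))"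
  proof (intro iffI; elim exE conjE bexE)
    fix R x assume "naa_refinement (naa_of_lts L) A R" "x \<in> naa_init A" "(lts_init L, x) \<in> R"
    then show "\<exists>\<sigma>. nu_postfixed L (nuhml_of_naa A) \<sigma> \<and> (\<exists>x\<in>naa_init A. lts_init L \<in> \<sigma> x)"
      by (intro exI[of _ "\<lambda>x. R\<inverse> `` {x}"]) (auto simp: nu_postfixed_nuhml_of_naa_iff)
  qed (auto simp: nu_postfixed_nuhml_of_naa_iff)
  then show "L \<in> nuhml_impls (nuhml_of_naa A) \<longleftrightarrow> L \<in> naa_impls A"
    by (simp add: nuhml_impls_iff naa_impls_iff nuhml_of_naa_def)
qed

end

section \<open>From the nu-calculus to acceptance automata\<close>

primrec subformulas :: "('a, 'x) hml \<Rightarrow> ('a, 'x) hml set" where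
  "subformulas TT = {TT}"
| "subformulas FF = {FF}"
| "subformulas (Var x) = {Var x}"
| "subformulas (And \<phi> \<psi>) = insert (And \<phi> \<psi>) (subformulas \<phi> \<union> subformulas \<psi>)"
| "subformulas (Or \<phi> \<psi>) = insert (Or \<phi> \<psi>) (subformulas \<phi> \<union> subformulas \<psi>)"
| "subformulas (Dia a \<phi>) = insert (Dia a \<phi>) (subformulas \<phi>)"
| "subformulas (Box a \<phi>) = insert (Box a \<phi>) (subformulas \<phi>)"

lemma finite_subformulas: "finite (subformulas \<phi>)"
  by (induction \<phi>) auto

lemma self_in_subformulas [simp]: "\<phi> \<in> subformulas \<phi>"
  by (cases \<phi>) auto

lemma subformulas_trans: "\<lbrakk>\<chi> \<in> subformulas \<psi>; \<psi> \<in> subformulas \<phi>\<rbrakk> \<Longrightarrow> \<chi> \<in> subformulas \<phi>"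
  by (induction \<phi>) auto

lemma Var_in_subformulas: "Var x \<in> subformulas \<phi> \<Longrightarrow> x \<in> vars \<phi>"
  by (induction \<phi>) auto

definition nu_closure :: "('a, 'x) nuhml \<Rightarrow> ('a, 'x) hml set" where
  "nu_closure F = (\<Union>x\<in>nu_vars F. insert (Var x) (subformulas (nu_decl F x)))"

lemma finite_nu_closure: "is_nuhml F \<Longrightarrow> finite (nu_closure F)"
  by (simp add: nu_closure_def is_nuhml_def finite_subformulas)

lemma subformulas_nu_closure:
  "\<lbrakk>\<psi> \<in> subformulas \<phi>; \<phi> \<in> nu_closure F\<rbrakk> \<Longrightarrow> \<psi> \<in> nu_closure F"
  by (auto simp: nu_closure_def dest: subformulas_trans)

lemma nu_closureD:
  shows "And \<phi> \<psi> \<in> nu_closure F \<Longrightarrow> \<phi> \<in> nu_closure F \<and> \<psi> \<in> nu_closure F"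
    and "Or \<phi> \<psi> \<in> nu_closure F \<Longrightarrow> \<phi> \<in> nu_closure F \<and> \<psi> \<in> nu_closure F"
    and "Dia a \<phi> \<in> nu_closure F \<Longrightarrow> \<phi> \<in> nu_closure F"
    and "Box a \<phi> \<in> nu_closure F \<Longrightarrow> \<phi> \<in> nu_closure F"
  by (auto elim!: subformulas_nu_closure[rotated])

lemma Var_in_nu_closure_iff: "is_nuhml F \<Longrightarrow> Var x \<in> nu_closure F \<longleftrightarrow> x \<in> nu_vars F"
  by (auto simp: nu_closure_def is_nuhml_def dest: Var_in_subformulas)

lemma nu_decl_in_nu_closure: "x \<in> nu_vars F \<Longrightarrow> nu_decl F x \<in> nu_closure F"
  unfolding nu_closure_def by (rule UN_I[of x]) simp_all

definition hintikka_sets :: "('a, 'x) nuhml \<Rightarrow> ('a, 'x) hml set set" where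
  "hintikka_sets F = {U. U \<subseteq> nu_closure F \<and> FF \<notin> U
     \<and> (\<forall>x. Var x \<in> U \<longrightarrow> nu_decl F x \<in> U)
     \<and> (\<forall>\<phi> \<psi>. And \<phi> \<psi> \<in> U \<longrightarrow> \<phi> \<in> U \<and> \<psi> \<in> U)
     \<and> (\<forall>\<phi> \<psi>. Or \<phi> \<psi> \<in> U \<longrightarrow> \<phi> \<in> U \<or> \<psi> \<in> U)}"

lemma finite_hintikka_sets: "is_nuhml F \<Longrightarrow> finite (hintikka_sets F)"
  by (rule finite_subset[of _ "Pow (nu_closure F)"])
    (auto simp: hintikka_sets_def finite_nu_closure)

lemma hintikka_setsD:
  assumes "U \<in> hintikka_sets F"
  shows "U \<subseteq> nu_closure F" and "FF \<notin> U"
    and "Var x \<in> U \<Longrightarrow> nu_decl F x \<in> U"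
    and "And \<phi> \<psi> \<in> U \<Longrightarrow> \<phi> \<in> U \<and> \<psi> \<in> U"
    and "Or \<phi> \<psi> \<in> U \<Longrightarrow> \<phi> \<in> U \<or> \<psi> \<in> U"
  using assms unfolding hintikka_sets_def by blast+

definition naa_of_nuhml :: "('a, 'x) nuhml \<Rightarrow> ('a, ('a, 'x) hml set) naa" where
  "naa_of_nuhml F = \<lparr>naa_states = hintikka_sets F,
     naa_init = {U \<in> hintikka_sets F. \<exists>x\<in>nu_init F. Var x \<in> U},
     naa_tran = (\<lambda>U. {M. M \<subseteq> UNIV \<times> hintikka_sets F
       \<and> (\<forall>a \<phi>. Dia a \<phi> \<in> U \<longrightarrow> (\<exists>V. (a, V) \<in> M \<and> \<phi> \<in> V))
       \<and> (\<forall>a \<phi>. Box a \<phi> \<in> U \<longrightarrow> (\<forall>V. (a, V) \<in> M \<longrightarrow> \<phi> \<in> V))})\<rparr>"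

lemma is_naa_naa_of_nuhml:
  fixes F :: "('a::finite, 'x) nuhml"
  assumes "is_nuhml F"
  shows "is_naa (naa_of_nuhml F)"
proof -
  have "finite M" if "M \<subseteq> UNIV \<times> hintikka_sets F" for M :: "('a \<times> ('a, 'x) hml set) set"
    using that by (rule finite_subset) (simp add: finite_hintikka_sets assms)
  then show ?thesis
    by (auto simp: is_naa_def naa_of_nuhml_def Fpow_def finite_hintikka_sets assms)
qed

definition satisfied_formulas ::
  "('a, 's) lts \<Rightarrow> ('a, 'x) nuhml \<Rightarrow> ('x \<Rightarrow> 's set) \<Rightarrow> 's \<Rightarrow> ('a, 'x) hml set" where
  "satisfied_formulas L F \<sigma> i = {\<phi> \<in> nu_closure F. i \<in> hml_sem L \<phi> \<sigma>}"

lemma satisfied_formulas_in_hintikka_sets: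
  assumes "is_nuhml F" "nu_postfixed L F \<sigma>"
  shows "satisfied_formulas L F \<sigma> i \<in> hintikka_sets F"
  using assms
  by (auto simp: satisfied_formulas_def hintikka_sets_def Var_in_nu_closure_iff
      nu_decl_in_nu_closure nu_postfixed_def dest: nu_closureD)

lemma naa_refinement_naa_of_nuhml:
  assumes F: "is_nuhml F" and L: "is_lts L" and \<sigma>: "nu_postfixed L F \<sigma>"
  shows "naa_refinement (naa_of_lts L) (naa_of_nuhml F)
    ((\<lambda>i. (i, satisfied_formulas L F \<sigma> i)) ` lts_states L)"
    (is "naa_refinement _ _ ?graph")
proof -
  let ?sat = "satisfied_formulas L F \<sigma>"
  have hintikka: "?sat i \<in> hintikka_sets F" for i
    using F \<sigma> by (rule satisfied_formulas_in_hintikka_sets)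
  have "\<exists>M\<in>naa_tran (naa_of_nuhml F) (?sat i). bimatched ?graph (lts_trans L `` {i}) M" for i
  proof
    show "map_prod id ?sat ` (lts_trans L `` {i}) \<in> naa_tran (naa_of_nuhml F) (?sat i)"
      using hintikka
      by (force simp: naa_of_nuhml_def satisfied_formulas_def dest: nu_closureD)
    show "bimatched ?graph (lts_trans L `` {i}) (map_prod id ?sat ` (lts_trans L `` {i}))"
      using L by (intro bimatched_image) (auto simp: is_lts_def)
  qed
  moreover have "?graph \<subseteq> lts_states L \<times> naa_states (naa_of_nuhml F)"
    using hintikka by (auto simp: naa_of_nuhml_def)
  ultimately show ?thesis
    by (auto simp: naa_refinement_lts_iff)
qed

definition refinement_assignment :: "('s \<times> ('a, 'x) hml set) set \<Rightarrow> 'x \<Rightarrow> 's set" where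
  "refinement_assignment R x = {i. \<exists>U. (i, U) \<in> R \<and> Var x \<in> U}"

context
  fixes L :: "('a, 's) lts" and F :: "('a, 'x) nuhml" and R :: "('s \<times> ('a, 'x) hml set) set"
  assumes R: "naa_refinement (naa_of_lts L) (naa_of_nuhml F) R"
begin

lemma hintikka_refinement_lts_states: "(i, U) \<in> R \<Longrightarrow> i \<in> lts_states L"
  using R by (auto simp: naa_refinement_lts_iff)

lemma hintikka_refinement_hintikka_sets: "(i, U) \<in> R \<Longrightarrow> U \<in> hintikka_sets F"
  using R by (auto simp: naa_refinement_lts_iff naa_of_nuhml_def)

lemma hintikka_refinement_DiaE:
  assumes "(i, U) \<in> R" "Dia a \<phi> \<in> U"
  obtains j V where "(i, a, j) \<in> lts_trans L" "(j, V) \<in> R" "\<phi> \<in> V"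
proof -
  obtain M where M: "M \<in> naa_tran (naa_of_nuhml F) U"
    and match: "bimatched R (lts_trans L `` {i}) M"
    using R assms(1) unfolding naa_refinement_lts_iff by blast
  obtain V where V: "(a, V) \<in> M" "\<phi> \<in> V"
    using M assms(2) unfolding naa_of_nuhml_def by auto blast
  have "matched (R\<inverse>) M (lts_trans L `` {i})"
    using match by (simp add: bimatched_def)
  from this V(1) obtain j where "(a, j) \<in> lts_trans L `` {i}" "(V, j) \<in> R\<inverse>"
    by (rule matchedE)
  then show ?thesis
    using V(2) by (intro that) auto
qed

lemma hintikka_refinement_BoxE:
  assumes "(i, U) \<in> R" "Box a \<phi> \<in> U" "(i, a, j) \<in> lts_trans L"
  obtains V where "(j, V) \<in> R" "\<phi> \<in> V"
proof -
  obtain M where M: "M \<in> naa_tran (naa_of_nuhml F) U"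
    and match: "bimatched R (lts_trans L `` {i}) M"
    using R assms(1) unfolding naa_refinement_lts_iff by blast
  have "matched R (lts_trans L `` {i}) M" "(a, j) \<in> lts_trans L `` {i}"
    using match assms(3) by (simp_all add: bimatched_def)
  then obtain V where "(a, V) \<in> M" "(j, V) \<in> R"
    by (rule matchedE)
  moreover from this(1) have "\<phi> \<in> V"
    using M assms(2) by (auto simp: naa_of_nuhml_def)
  ultimately show ?thesis
    by (intro that)
qed

lemma hml_sem_refinement_assignment:
  "\<lbrakk>(i, U) \<in> R; \<phi> \<in> U\<rbrakk> \<Longrightarrow> i \<in> hml_sem L \<phi> (refinement_assignment R)"
proof (induction \<phi> arbitrary: i U)
  case TT
  then show ?case
    by (simp add: hintikka_refinement_lts_states)
next
  case FF
  then show ?case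
    using hintikka_setsD(2) hintikka_refinement_hintikka_sets by blast
next
  case (Var x)
  then show ?case
    by (auto simp: refinement_assignment_def)
next
  case (And \<phi> \<psi>)
  then show ?case
    using hintikka_setsD(4)[OF hintikka_refinement_hintikka_sets[OF And.prems(1)] And.prems(2)]
    by auto
next
  case (Or \<phi> \<psi>)
  then show ?case
    using hintikka_setsD(5)[OF hintikka_refinement_hintikka_sets[OF Or.prems(1)] Or.prems(2)]
    by auto
next
  case (Dia a \<phi>)
  from Dia.prems obtain j V where "(i, a, j) \<in> lts_trans L" "(j, V) \<in> R" "\<phi> \<in> V"
    by (rule hintikka_refinement_DiaE)
  then show ?case
    using Dia.IH hintikka_refinement_lts_states[OF Dia.prems(1)] by auto
next
  case (Box a \<phi>)
  then show ?case
    by (auto simp: hintikka_refinement_lts_states elim: hintikka_refinement_BoxE)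
qed

lemma nu_postfixed_refinement_assignment:
  assumes F: "is_nuhml F"
  shows "nu_postfixed L F (refinement_assignment R)"
proof -
  have "x \<in> nu_vars F" if "(i, U) \<in> R" "Var x \<in> U" for i U x
    using hintikka_setsD(1)[OF hintikka_refinement_hintikka_sets[OF that(1)]] that(2)
      Var_in_nu_closure_iff[OF F] by blast
  then have "nu_assignment L F (refinement_assignment R)"
    by (auto simp: nu_assignment_def refinement_assignment_def hintikka_refinement_lts_states)
  moreover have "refinement_assignment R x \<subseteq> hml_sem L (nu_decl F x) (refinement_assignment R)"
    for x
    using hml_sem_refinement_assignment hintikka_setsD(3)[OF hintikka_refinement_hintikka_sets]
    unfolding refinement_assignment_def[of R x] by blast
  ultimately show ?thesis
    by (simp add: nu_postfixed_def)
qed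

end

lemma naa_impls_naa_of_nuhml:
  assumes F: "is_nuhml F"
  shows "naa_impls (naa_of_nuhml F) = nuhml_impls F"
proof (intro Set.set_eqI iffI)
  fix L :: "('a, 's) lts"
  assume "L \<in> naa_impls (naa_of_nuhml F)"
  then obtain R U where L: "is_lts L" and R: "naa_refinement (naa_of_lts L) (naa_of_nuhml F) R"
    and "U \<in> naa_init (naa_of_nuhml F)" "(lts_init L, U) \<in> R"
    by (auto simp: naa_impls_iff)
  then have "\<exists>x\<in>nu_init F. lts_init L \<in> refinement_assignment R x"
    by (auto simp: naa_of_nuhml_def refinement_assignment_def)
  then show "L \<in> nuhml_impls F"
    unfolding nuhml_impls_iff using L nu_postfixed_refinement_assignment[OF R F] by blast
next
  fix L :: "('a, 's) lts"
  assume "L \<in> nuhml_impls F"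
  then obtain \<sigma> x where L: "is_lts L" and \<sigma>: "nu_postfixed L F \<sigma>"
    and x: "x \<in> nu_init F" "lts_init L \<in> \<sigma> x"
    by (auto simp: nuhml_impls_iff)
  have "Var x \<in> satisfied_formulas L F \<sigma> (lts_init L)"
    using F x by (auto simp: satisfied_formulas_def Var_in_nu_closure_iff is_nuhml_def)
  then have "satisfied_formulas L F \<sigma> (lts_init L) \<in> naa_init (naa_of_nuhml F)"
    using x(1) satisfied_formulas_in_hintikka_sets[OF F \<sigma>] by (auto simp: naa_of_nuhml_def)
  moreover have "lts_init L \<in> lts_states L"
    using L by (simp add: is_lts_def)
  ultimately show "L \<in> naa_impls (naa_of_nuhml F)"
    unfolding naa_impls_iff using L naa_refinement_naa_of_nuhml[OF F L \<sigma>] by blast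
qed

section \<open>The equivalences\<close>

lemma ex_naa_eq_nuhml:
  fixes F :: "('a::finite, 'x) nuhml"
  assumes F: "is_nuhml F"
  shows "\<exists>A :: ('a, 'q::infinite) naa.
    is_naa A \<and> finite (naa_states A) \<and> naa_impls A = (nuhml_impls F :: ('a, 's) lts set)"
proof -
  let ?A = "naa_of_nuhml F"
  have fin: "finite (naa_states ?A)"
    by (simp add: naa_of_nuhml_def finite_hintikka_sets F)
  then obtain e :: "('a, 'x) hml set \<Rightarrow> 'q" where e: "inj_on e (naa_states ?A)"
    using arb_inj_on_finite_infinite by blast
  have "finite (naa_states (naa_image e ?A))"
    using fin by (simp add: naa_image_def)
  then show ?thesis
    using is_naa_naa_image naa_impls_naa_image[OF _ e] is_naa_naa_of_nuhml[OF F]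
      naa_impls_naa_of_nuhml[OF F] by metis
qed

lemma ex_nuhml_eq_naa:
  fixes A :: "('a::finite, 'q) naa"
  assumes A: "is_naa A" and fin: "finite (naa_states A)"
  shows "\<exists>F :: ('a, 'x::infinite) nuhml.
    is_nuhml F \<and> nuhml_impls F = (naa_impls A :: ('a, 's) lts set)"
proof -
  obtain e :: "'q \<Rightarrow> 'x" where e: "inj_on e (naa_states A)"
    using arb_inj_on_finite_infinite[OF fin] by blast
  have "is_naa (naa_image e A)" "finite (naa_states (naa_image e A))"
    using A fin by (simp_all add: is_naa_naa_image) (simp add: naa_image_def)
  then show ?thesis
    using is_nuhml_nuhml_of_naa nuhml_impls_nuhml_of_naa naa_impls_naa_image[OF A e] by metis
qed

lemma ex_inj_on_UN_finite:
  includes cardinal_syntax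
  fixes I :: "'b::infinite set" and B :: "'b \<Rightarrow> 'c set"
  assumes "\<And>i. i \<in> I \<Longrightarrow> finite (B i)"
  shows "\<exists>e :: 'c \<Rightarrow> 'b. inj_on e (\<Union>i\<in>I. B i)"
proof -
  have "|B i| \<le>o |UNIV :: 'b set|" if "i \<in> I" for i
    using arb_inj_on_finite_infinite[OF assms[OF that]] by (simp flip: card_of_ordLeq)
  moreover have "|I| \<le>o |UNIV :: 'b set|"
    by (simp add: card_of_mono1)
  ultimately have "|\<Union>i\<in>I. B i| \<le>o |UNIV :: 'b set|"
    by (intro card_of_UNION_ordLeq_infinite infinite_UNIV) auto
  then show ?thesis
    by (simp flip: card_of_ordLeq)
qed

lemma ex_dmts_eq_naa:
  fixes A :: "('a, 'q::infinite) naa"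
  assumes A: "is_naa A" and fin: "naa_locally_finite A"
  shows "\<exists>D :: ('a, 'q) dmts. is_dmts D \<and> (finite (naa_states A) \<longrightarrow> finite (dmts_states D))
    \<and> dmts_impls D = (naa_impls A :: ('a, 's) lts set)"
proof -
  let ?D = "dmts_of_naa A"
  have states: "dmts_states ?D = (\<Union>s\<in>naa_states A. naa_tran A s)"
    by (simp add: dmts_of_naa_def acceptance_sets_def)
  then obtain e :: "('a \<times> 'q) set \<Rightarrow> 'q" where e: "inj_on e (dmts_states ?D)"
    using ex_inj_on_UN_finite[of "naa_states A" "naa_tran A"] fin
    by (auto simp: naa_locally_finite_def)
  have "finite (naa_states A) \<longrightarrow> finite (dmts_states (dmts_image e ?D))"
    using fin by (simp add: dmts_image_def states naa_locally_finite_def)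
  then show ?thesis
    using is_dmts_dmts_image[OF _ e] dmts_impls_dmts_image[OF _ e] is_dmts_dmts_of_naa[OF A fin]
      dmts_impls_dmts_of_naa[OF A] by metis
qed

lemma ex_naa_eq_dmts:
  fixes D :: "('a::finite, 'q) dmts"
  assumes "is_dmts D"
  shows "\<exists>A :: ('a, 'q) naa. is_naa A \<and> naa_locally_finite A
    \<and> naa_states A = dmts_states D \<and> naa_impls A = (dmts_impls D :: ('a, 's) lts set)"
  using is_naa_naa_of_dmts[OF assms] naa_locally_finite_naa_of_dmts[OF assms]
    naa_impls_naa_of_dmts[OF assms]
  by (intro exI[of _ "naa_of_dmts D"]) (simp add: naa_of_dmts_def)

theorem theorem1:
  fixes \<S> :: "('a::finite, 's) lts set"
  assumes "\<S> \<subseteq> {L. is_lts L}"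
  shows
    "((\<exists>F :: ('a, 'x::infinite) nuhml. is_nuhml F \<and> nuhml_impls F = \<S>) \<longleftrightarrow>
      (\<exists>A :: ('a, 'q::infinite) naa. is_naa A \<and> finite (naa_states A) \<and> naa_impls A = \<S>))
   \<and> ((\<exists>A :: ('a, 'q) naa. is_naa A \<and> finite (naa_states A) \<and> naa_impls A = \<S>) \<longleftrightarrow>
      (\<exists>D :: ('a, 'q) dmts. is_dmts D \<and> finite (dmts_states D) \<and> dmts_impls D = \<S>))
   \<and> ((\<exists>A :: ('a, 'q) naa. is_naa A \<and> naa_locally_finite A \<and> naa_impls A = \<S>) \<longleftrightarrow>
      (\<exists>D :: ('a, 'q) dmts. is_dmts D \<and> dmts_impls D = \<S>))"
  (is "(?nuhml \<longleftrightarrow> ?finite_naa) \<and> (_ \<longleftrightarrow> ?finite_dmts) \<and> (?naa \<longleftrightarrow> ?dmts)")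
proof (intro conjI)
  show "?nuhml \<longleftrightarrow> ?finite_naa"
    using ex_naa_eq_nuhml ex_nuhml_eq_naa by blast
  show "?finite_naa \<longleftrightarrow> ?finite_dmts"
    using ex_dmts_eq_naa[OF _ finite_naa_locally_finite] ex_naa_eq_dmts by metis
  show "?naa \<longleftrightarrow> ?dmts"
    using ex_dmts_eq_naa ex_naa_eq_dmts by metis
qed

end
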